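(* Let $T=(\mathcal V,\mathcal C,\mathcal E)$ be the subgraph induced by a stabilizer generator of a generalized bicycle code whose defining matrices are sums of distinct monomials, $A=\sum_{i=1}^m A_i$ and $B=\sum_{j=1}^n B_j$ (with $m,n\ge1$), and suppose that $T$ is isomorphic to a subdivided $K_{m,n}$ with variable-node partition $\mathcal V=\mathcal A\sqcup\mathcal B$, $|\mathcal A|=m$, $|\mathcal B|=n$, where $\mathcal A$ and $\mathcal B$ are the parts of the support of the generator in the first and second block of the code. Assume that the edges are labeled by the monomials inducing them: the edges incident to variable nodes of $\mathcal A$ are labeled by $n$ distinct edge labels $\alpha_1,\dots,\alpha_n$, where $\alpha_j$ corresponds to the monomial $B_j$, while the edges incident to variable nodes of $\mathcal B$ are labeled by $m$ distinct edge labels $\beta_1,\dots,\beta_m$, where $\beta_i$ corresponds to the monomial $A_i$, with $$\{\alpha_1,\dots,\alpha_n\}\cap\{\beta_1,\dots,\beta_m\}=\varnothing.$$ Then every degree-2 check node $c\in\mathcal C$ is uniquely identified by its ordered pair of labels $$\eta(c)=(\alpha_j,\beta_i),\qquad 1\le j\le n,\ 1\le i\le m,$$ where the first entry is the label of the edge joining $c$ to its neighbor in $\mathcal A$ and the second entry is the label of the edge joining $c$ to its neighbor in $\mathcal B$, and all such ordered pairs appear exactly once. Consequently, no nontrivial color-preserving automorphism of $T$ can map one error pattern to a distinct error pattern; that is, if $\psi$ is a color-preserving automorphism of $T$ and $\mathcal P\subseteq\mathcal V$, then $\psi(\mathcal P)=\mathcal P$.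
   Context: **Generalized bicycle (GB) codes.** Let $L_x,L_y\ge1$, let $S_L$ be the $L\times L$ cyclic shift permutation matrix over $\mathbb F_2$, and put $x=S_{L_x}\otimes I_{L_y}$, $y=I_{L_x}\otimes S_{L_y}$, so $xy=yx$ and $x^{L_x}=y^{L_y}=I$. A monomial is a permutation matrix $x^ay^b$ (for standard GB codes based on circulants, $L_y=1$ and monomials are powers $x^a$). A GB code is given by binary matrices $A$, $B$, each a sum of monomials (so $AB=BA$), with parity-check matrices $H_X=[A\;\,B]$ and $H_Z=[B^T\;\,A^T]$. The columns of the left and right halves index the variable nodes of the first and second block, respectively. **Tanner graph and induced subgraph.** The Tanner graph of $H_Z$ has the columns of $H_Z$ as variable nodes, the rows as check nodes, and an edge $(v,c)$ whenever the entry of $H_Z$ in row $c$ and column $v$ is $1$. A stabilizer generator is a row of $H_X$. The subgraph $T$ it induces consists of the variable nodes $\mathcal V$ in the support of that row, all check nodes $\mathcal C$ adjacent to at least one of them, and all edges $\mathcal E$ between these nodes. **Edge labels.** The Tanner graph edge between check $c$ and a first-block variable $v$ is induced by the unique monomial $B_j$ with $(B_j^T)_{c,v}=1$; the edge between check $c$ and a second-block variable $v$ is induced by the unique monomial $A_i$ with $(A_i^T)_{c,v}=1$. The edge label records this monomial; labels coming from $A$ and labels coming from $B$ are regarded as different. **Subdivided $K_{m,n}$.** This is the Tanner graph whose variable nodes are the vertices of $K_{m,n}$, with sides $\mathcal A,\mathcal B$, and which has exactly one degree-2 check node for each pair $(a,b)\in\mathcal A\times\mathcal B$, adjacent exactly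 to $a$ and $b$; it has no other check nodes. **Automorphisms and error patterns.** A color-preserving automorphism of $T$ is a graph automorphism mapping $\mathcal V$ to $\mathcal V$ and $\mathcal C$ to $\mathcal C$ and preserving the label of every edge. An error pattern is a subset of $\mathcal V$. *)

theory Defs
  imports "Jordan_Normal_Form.Matrix" "HOL-Library.Z2"
begin

text \<open>
  Matrices over the two-element field are of type \<open>bit mat\<close>; rows and columns are indexed from 0.
\<close>

definition cyclic_shift :: "nat \<Rightarrow> bit mat" where
  "cyclic_shift L = mat L L (\<lambda>(i, j). if j = (i + 1) mod L then 1 else 0)"

definition kronecker :: "'a::times mat \<Rightarrow> 'a mat \<Rightarrow> 'a mat" where
  "kronecker P Q = mat (dim_row P * dim_row Q) (dim_col P * dim_col Q)
     (\<lambda>(i, j). P $$ (i div dim_row Q, j div dim_col Q) * Q $$ (i mod dim_row Q, j mod dim_col Q))"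

definition gb_x :: "nat \<Rightarrow> nat \<Rightarrow> bit mat" where
  "gb_x Lx Ly = kronecker (cyclic_shift Lx) (1\<^sub>m Ly)"

definition gb_y :: "nat \<Rightarrow> nat \<Rightarrow> bit mat" where
  "gb_y Lx Ly = kronecker (1\<^sub>m Lx) (cyclic_shift Ly)"

definition monomials :: "nat \<Rightarrow> nat \<Rightarrow> bit mat set" where
  "monomials Lx Ly = {gb_x Lx Ly ^\<^sub>m a * gb_y Lx Ly ^\<^sub>m b | a b. True}"

definition matrix_sum :: "nat \<Rightarrow> nat \<Rightarrow> (nat \<Rightarrow> bit mat) \<Rightarrow> bit mat" where
  "matrix_sum N k M = mat N N (\<lambda>(i, j). \<Sum>t = 1..k. M t $$ (i, j))"

definition hconcat :: "'a mat \<Rightarrow> 'a mat \<Rightarrow> 'a mat" where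
  "hconcat P Q = mat (dim_row P) (dim_col P + dim_col Q)
     (\<lambda>(i, j). if j < dim_col P then P $$ (i, j) else Q $$ (i, j - dim_col P))"

definition H_X :: "bit mat \<Rightarrow> bit mat \<Rightarrow> bit mat" where
  "H_X A B = hconcat A B"

definition H_Z :: "bit mat \<Rightarrow> bit mat \<Rightarrow> bit mat" where
  "H_Z A B = hconcat (transpose_mat B) (transpose_mat A)"


text \<open>
  Tanner graphs are bipartite, so an (undirected) edge is stored as the pair
  (variable node, check node).
\<close>

record 'a tanner_graph =
  var_nodes :: "'a set"
  check_nodes :: "'a set"
  edges :: "('a \<times> 'a) set"

definition check_degree :: "'a tanner_graph \<Rightarrow> 'a \<Rightarrow> nat" where
  "check_degree G c = card {v \<in> var_nodes G. (v, c) \<in> edges G}"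

definition tanner_iso :: "'a tanner_graph \<Rightarrow> 'b tanner_graph \<Rightarrow> ('a \<Rightarrow> 'b) \<Rightarrow> bool" where
  "tanner_iso G H \<phi> \<longleftrightarrow>
     bij_betw \<phi> (var_nodes G \<union> check_nodes G) (var_nodes H \<union> check_nodes H) \<and>
     \<phi> ` var_nodes G = var_nodes H \<and>
     \<phi> ` check_nodes G = check_nodes H \<and>
     (\<forall>v \<in> var_nodes G. \<forall>c \<in> check_nodes G. (v, c) \<in> edges G \<longleftrightarrow> (\<phi> v, \<phi> c) \<in> edges H)"

definition color_preserving_automorphism ::
    "'a tanner_graph \<Rightarrow> ('a \<times> 'a \<Rightarrow> 'l) \<Rightarrow> ('a \<Rightarrow> 'a) \<Rightarrow> bool" where
  "color_preserving_automorphism G lab \<psi> \<longleftrightarrow>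
     tanner_iso G G \<psi> \<and> (\<forall>(v, c) \<in> edges G. lab (\<psi> v, \<psi> c) = lab (v, c))"

datatype code_node = Var nat | Check nat

definition tanner_graph_of :: "bit mat \<Rightarrow> code_node tanner_graph" where
  "tanner_graph_of H =
     \<lparr>var_nodes = Var ` {..<dim_col H},
      check_nodes = Check ` {..<dim_row H},
      edges = {(Var v, Check c) | v c. v < dim_col H \<and> c < dim_row H \<and> H $$ (c, v) = 1}\<rparr>"

definition induced_by :: "'a tanner_graph \<Rightarrow> 'a set \<Rightarrow> 'a tanner_graph" where
  "induced_by G W =
     \<lparr>var_nodes = W,
      check_nodes = {c \<in> check_nodes G. \<exists>v \<in> W. (v, c) \<in> edges G},
      edges = {(v, c) \<in> edges G. v \<in> W}\<rparr>"

definition row_support :: "bit mat \<Rightarrow> nat \<Rightarrow> code_node set" where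
  "row_support H r = Var ` {v. v < dim_col H \<and> H $$ (r, v) = 1}"

definition generator_subgraph :: "bit mat \<Rightarrow> bit mat \<Rightarrow> nat \<Rightarrow> code_node tanner_graph" where
  "generator_subgraph A B r = induced_by (tanner_graph_of (H_Z A B)) (row_support (H_X A B) r)"

definition first_block :: "nat \<Rightarrow> code_node set" where
  "first_block N = Var ` {..<N}"

definition second_block :: "nat \<Rightarrow> code_node set" where
  "second_block N = Var ` {N..<2 * N}"


datatype k_node = SideA nat | SideB nat | Mid nat nat

definition subdivided_K :: "nat \<Rightarrow> nat \<Rightarrow> k_node tanner_graph" where
  "subdivided_K m n =
     \<lparr>var_nodes = SideA ` {1..m} \<union> SideB ` {1..n},
      check_nodes = {Mid i j | i j. i \<in> {1..m} \<and> j \<in> {1..n}},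
      edges = {(SideA i, Mid i j) | i j. i \<in> {1..m} \<and> j \<in> {1..n}} \<union>
              {(SideB j, Mid i j) | i j. i \<in> {1..m} \<and> j \<in> {1..n}}\<rparr>"

definition is_subdivided_K ::
    "'a tanner_graph \<Rightarrow> 'a set \<Rightarrow> 'a set \<Rightarrow> nat \<Rightarrow> nat \<Rightarrow> bool" where
  "is_subdivided_K G P Q m n \<longleftrightarrow>
     var_nodes G = P \<union> Q \<and> P \<inter> Q = {} \<and> card P = m \<and> card Q = n \<and>
     (\<exists>\<phi>. tanner_iso G (subdivided_K m n) \<phi> \<and>
          \<phi> ` P = SideA ` {1..m} \<and> \<phi> ` Q = SideB ` {1..n})"


text \<open>
  The constructors keep labels coming from \<open>A\<close> and labels coming from \<open>B\<close> apart even
  when the same monomial occurs in both sums.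
\<close>

datatype edge_label = LabelA "bit mat" | LabelB "bit mat"

text \<open>
  \<open>As\<close> and \<open>Bs\<close> are the sets of monomials of the two sums. Distinct monomials have no common
  nonzero entry, so on an edge of the Tanner graph the monomial selected by \<open>THE\<close> exists and is
  unique.  The value on pairs that are not of the form (variable, check) is irrelevant.
\<close>

fun label_of :: "nat \<Rightarrow> bit mat set \<Rightarrow> bit mat set \<Rightarrow> code_node \<times> code_node \<Rightarrow> edge_label" where
  "label_of N As Bs (Var v, Check c) =
     (if v < N then LabelB (THE M. M \<in> Bs \<and> transpose_mat M $$ (c, v) = 1)
      else LabelA (THE M. M \<in> As \<and> transpose_mat M $$ (c, v - N) = 1))"
| "label_of N As Bs _ = undefined"

definition neighbor_in :: "'a tanner_graph \<Rightarrow> 'a set \<Rightarrow> 'a \<Rightarrow> 'a" where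
  "neighbor_in G S c = (THE v. v \<in> S \<and> (v, c) \<in> edges G)"

definition label_pair ::
    "'a tanner_graph \<Rightarrow> 'a set \<Rightarrow> 'a set \<Rightarrow> ('a \<times> 'a \<Rightarrow> 'l) \<Rightarrow> 'a \<Rightarrow> 'l \<times> 'l" where
  "label_pair G P Q lab c = (lab (neighbor_in G P c, c), lab (neighbor_in G Q c, c))"

end

theory Submission
  imports Defs "HOL-Number_Theory.Cong"
begin

text \<open>
  Monomials act on the indices below \<open>N\<close> as translations of \<open>\<int>/Lx \<times> \<int>/Ly\<close>. Writing \<open>f i\<close>, \<open>g j\<close> for
  the translations given by \<open>A\<^sub>i\<close>, \<open>B\<^sub>j\<close>, the generator \<open>r\<close> has variable nodes \<open>f i r\<close> (first block)
  and \<open>g j r\<close> (second block), and since translations commute, \<open>f i (g j r)\<close> is a common neighbour of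
  these two, reached along edges labelled \<open>B\<^sub>j\<close> and \<open>A\<^sub>i\<close>. A subdivided \<open>K\<^sub>m\<^sub>,\<^sub>n\<close> has \<open>m n\<close> checks, so
  the checks \<open>f i (g j r)\<close> are pairwise distinct. Hence a label pair determines its check together
  with both neighbours, and a label-preserving automorphism fixes every node.
\<close>

section \<open>Graphs whose checks are indexed by label pairs\<close>

text \<open>An edge on the \<open>a\<close> side records only \<open>j\<close>, an edge on the
  \<open>b\<close> side only \<open>i\<close>. With \<open>inj_c\<close>, the two labels at a check
  therefore act as coordinates for it.\<close>

locale label_indexed_graph =
  fixes T :: "'a tanner_graph" and lab :: "'a \<times> 'a \<Rightarrow> 'l"
    and I :: "'i set" and J :: "'j set"
    and a :: "'i \<Rightarrow> 'a" and b :: "'j \<Rightarrow> 'a" and c :: "'i \<Rightarrow> 'j \<Rightarrow> 'a"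
    and \<alpha> :: "'j \<Rightarrow> 'l" and \<beta> :: "'i \<Rightarrow> 'l"
  assumes var_nodes: "var_nodes T = a ` I \<union> b ` J"
    and check_nodes: "check_nodes T = (\<lambda>(i, j). c i j) ` (I \<times> J)"
    and edges: "edges T = (\<lambda>(i, j). (a i, c i j)) ` (I \<times> J) \<union> (\<lambda>(i, j). (b j, c i j)) ` (I \<times> J)"
    and sides_disjoint: "a ` I \<inter> b ` J = {}"
    and inj_c: "inj_on (\<lambda>(i, j). c i j) (I \<times> J)"
    and lab_a: "i \<in> I \<Longrightarrow> j \<in> J \<Longrightarrow> lab (a i, c i j) = \<alpha> j"
    and lab_b: "i \<in> I \<Longrightarrow> j \<in> J \<Longrightarrow> lab (b j, c i j) = \<beta> i"
    and inj_\<alpha>: "inj_on \<alpha> J" and inj_\<beta>: "inj_on \<beta> I"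
    and labels_disjoint: "\<alpha> ` J \<inter> \<beta> ` I = {}"
begin

lemma c_eq_iff:
  "i \<in> I \<Longrightarrow> j \<in> J \<Longrightarrow> i' \<in> I \<Longrightarrow> j' \<in> J \<Longrightarrow> c i j = c i' j' \<longleftrightarrow> i = i' \<and> j = j'"
  using inj_c by (auto simp: inj_on_def)

lemma edge_iff:
  assumes "i \<in> I" "j \<in> J"
  shows "(v, c i j) \<in> edges T \<longleftrightarrow> v = a i \<or> v = b j"
  using assms by (auto simp: edges image_iff c_eq_iff)

lemma a_neq_b: "i \<in> I \<Longrightarrow> j \<in> J \<Longrightarrow> a i \<noteq> b j"
  using sides_disjoint by blast

lemma neighbor_a_iff: "i \<in> I \<Longrightarrow> j \<in> J \<Longrightarrow> v \<in> a ` I \<and> (v, c i j) \<in> edges T \<longleftrightarrow> v = a i"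
  using a_neq_b by (fastforce simp: edge_iff)

lemma neighbor_b_iff: "i \<in> I \<Longrightarrow> j \<in> J \<Longrightarrow> v \<in> b ` J \<and> (v, c i j) \<in> edges T \<longleftrightarrow> v = b j"
  using a_neq_b by (fastforce simp: edge_iff)

section \<open>Degrees and label pairs of the checks\<close>

lemma check_degree_c:
  assumes "i \<in> I" "j \<in> J"
  shows "check_degree T (c i j) = 2"
proof -
  have "{v \<in> var_nodes T. (v, c i j) \<in> edges T} = {a i, b j}"
    using assms by (auto simp: edge_iff var_nodes)
  then show ?thesis
    using a_neq_b[OF assms] by (simp add: check_degree_def)
qed

lemma label_pair_c:
  "i \<in> I \<Longrightarrow> j \<in> J \<Longrightarrow> label_pair T (a ` I) (b ` J) lab (c i j) = (\<alpha> j, \<beta> i)"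
  by (simp add: label_pair_def neighbor_in_def neighbor_a_iff neighbor_b_iff lab_a lab_b)

lemma check_nodeE:
  assumes "w \<in> check_nodes T"
  obtains i j where "i \<in> I" "j \<in> J" "w = c i j"
  using assms by (auto simp: check_nodes)

lemma inj_on_label_pair: "inj_on (label_pair T (a ` I) (b ` J) lab) (check_nodes T)"
  by (rule inj_onI, elim check_nodeE)
    (auto simp: label_pair_c inj_on_eq_iff[OF inj_\<alpha>] inj_on_eq_iff[OF inj_\<beta>])

lemma ex1_check_with_labels:
  assumes "i \<in> I" "j \<in> J"
  shows "\<exists>!w. w \<in> check_nodes T \<and> check_degree T w = 2 \<and>
    label_pair T (a ` I) (b ` J) lab w = (\<alpha> j, \<beta> i)"
proof (rule ex1I[of _ "c i j"])
  show "c i j \<in> check_nodes T \<and> check_degree T (c i j) = 2 \<and>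
    label_pair T (a ` I) (b ` J) lab (c i j) = (\<alpha> j, \<beta> i)"
    using assms by (auto simp: check_nodes check_degree_c label_pair_c)
  then show "w = c i j" if "w \<in> check_nodes T \<and> check_degree T w = 2 \<and>
    label_pair T (a ` I) (b ` J) lab w = (\<alpha> j, \<beta> i)" for w
    using that inj_onD[OF inj_on_label_pair, of w "c i j"] by simp
qed

section \<open>Rigidity under label-preserving automorphisms\<close>

text \<open>Disjointness of the two label sets rules out edges on the \<open>b\<close> side, and
  injectivity of \<open>\<alpha>\<close> fixes \<open>j\<close>; the index \<open>i\<close> stays
  open.\<close>

lemma edge_with_\<alpha>_label:
  assumes "(v, w) \<in> edges T" "lab (v, w) = \<alpha> j" "j \<in> J"
  obtains i where "i \<in> I" "v = a i" "w = c i j"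
proof -
  have "\<beta> i \<noteq> \<alpha> j" if "i \<in> I" for i
    using labels_disjoint assms(3) that by blast
  then show thesis
    using assms that
    by (auto simp: edges lab_a lab_b inj_on_eq_iff[OF inj_\<alpha>])
qed

lemma edge_with_\<beta>_label:
  assumes "(v, w) \<in> edges T" "lab (v, w) = \<beta> i" "i \<in> I"
  obtains j where "j \<in> J" "v = b j" "w = c i j"
proof -
  have "\<alpha> j \<noteq> \<beta> i" if "j \<in> J" for j
    using labels_disjoint assms(3) that by blast
  then show thesis
    using assms that
    by (auto simp: edges lab_a lab_b inj_on_eq_iff[OF inj_\<beta>])
qed

text \<open>The two edges at \<open>c i j\<close> have images that meet in one check. The
  \<open>\<alpha>\<close> label preserves the second index of that check, the \<open>\<beta>\<close>
  label the first, so the check and both of its neighbours are fixed.\<close>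

lemma color_preserving_automorphism_fixes:
  assumes \<psi>: "color_preserving_automorphism T lab \<psi>" and i: "i \<in> I" and j: "j \<in> J"
  shows "\<psi> (a i) = a i" and "\<psi> (b j) = b j"
proof -
  have edge: "(\<psi> v, \<psi> (c i j)) \<in> edges T" "lab (\<psi> v, \<psi> (c i j)) = lab (v, c i j)"
    if "v = a i \<or> v = b j" for v
  proof -
    have "(v, c i j) \<in> edges T" "v \<in> var_nodes T" "c i j \<in> check_nodes T"
      using that i j by (auto simp: edge_iff var_nodes check_nodes)
    then show "(\<psi> v, \<psi> (c i j)) \<in> edges T" "lab (\<psi> v, \<psi> (c i j)) = lab (v, c i j)"
      using \<psi> by (auto simp: color_preserving_automorphism_def tanner_iso_def)
  qed
  obtain i' where i': "i' \<in> I" "\<psi> (a i) = a i'" "\<psi> (c i j) = c i' j"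
    using edge_with_\<alpha>_label[OF edge(1)[of "a i"]] edge(2)[of "a i"] i j by (auto simp: lab_a)
  obtain j' where j': "j' \<in> J" "\<psi> (b j) = b j'" "\<psi> (c i j) = c i j'"
    using edge_with_\<beta>_label[OF edge(1)[of "b j"]] edge(2)[of "b j"] i j by (auto simp: lab_b)
  \<comment> \<open>\<open>c i' j\<close> and \<open>c i j'\<close> are the same node, so their
    index pairs agree.\<close>
  have "i' = i" "j' = j"
    using i' j' i j by (auto simp: c_eq_iff)
  then show "\<psi> (a i) = a i" "\<psi> (b j) = b j"
    using i' j' by auto
qed

text \<open>Nonempty index sets put every variable node on an edge, which is what pins it
  down.\<close>

lemma color_preserving_automorphism_image:
  assumes "color_preserving_automorphism T lab \<psi>" "P \<subseteq> var_nodes T" "I \<noteq> {}" "J \<noteq> {}"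
  shows "\<psi> ` P = P"
proof -
  have "\<psi> v = v" if "v \<in> P" for v
    using that assms color_preserving_automorphism_fixes[OF assms(1)] by (auto simp: var_nodes)
  then show ?thesis
    by simp
qed

end

section \<open>Monomials as translations\<close>

text \<open>The index \<open>i\<close> stands for the point \<open>(i div Ly, i mod Ly)\<close> of
  the torus, the same encoding that \<open>kronecker\<close> uses.\<close>

definition translate :: "nat \<Rightarrow> nat \<Rightarrow> nat \<Rightarrow> nat \<Rightarrow> nat \<Rightarrow> nat" where
  "translate Lx Ly p q i = (i div Ly + p) mod Lx * Ly + (i mod Ly + q) mod Ly"

lemma translate_div: "0 < Ly \<Longrightarrow> translate Lx Ly p q i div Ly = (i div Ly + p) mod Lx"
  by (simp add: translate_def)

lemma translate_mod: "translate Lx Ly p q i mod Ly = (i mod Ly + q) mod Ly"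
  by (simp add: translate_def)

lemma nat_eq_iff_div_mod: "i = j \<longleftrightarrow> i div d = j div d \<and> i mod d = j mod d" for i j d :: nat
  by (metis div_mult_mod_eq)

lemma eq_translate_iff:
  "0 < Ly \<Longrightarrow> j = translate Lx Ly p q i \<longleftrightarrow>
    j div Ly = (i div Ly + p) mod Lx \<and> j mod Ly = (i mod Ly + q) mod Ly"
  by (subst nat_eq_iff_div_mod[of _ _ Ly]) (simp add: translate_div translate_mod)

lemma translate_less:
  assumes "0 < Lx" "0 < Ly"
  shows "translate Lx Ly p q i < Lx * Ly"
proof -
  have "translate Lx Ly p q i < (i div Ly + p) mod Lx * Ly + Ly"
    using assms by (simp add: translate_def)
  also have "\<dots> = Suc ((i div Ly + p) mod Lx) * Ly"
    by simp
  also have "\<dots> \<le> Lx * Ly"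
    using assms by (intro mult_right_mono) (simp_all add: Suc_leI)
  finally show ?thesis .
qed

lemma translate_zero: "i < Lx * Ly \<Longrightarrow> translate Lx Ly 0 0 i = i"
  by (simp add: translate_def less_mult_imp_div_less)

lemma translate_translate:
  "0 < Ly \<Longrightarrow>
    translate Lx Ly p q (translate Lx Ly p' q' i) = translate Lx Ly (p' + p) (q' + q) i"
  by (simp add: eq_translate_iff translate_div translate_mod mod_add_left_eq add.assoc)

lemma translate_commute:
  "0 < Ly \<Longrightarrow> translate Lx Ly p q (translate Lx Ly p' q' i) =
    translate Lx Ly p' q' (translate Lx Ly p q i)"
  by (simp add: translate_translate add.commute)

text \<open>Cancelling the coordinates of \<open>i\<close> leaves congruences between the shifts
  themselves: translations act freely.\<close>

lemma translate_eq_everywhere: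
  assumes "0 < Ly" "translate Lx Ly p q i = translate Lx Ly p' q' i"
  shows "translate Lx Ly p q = translate Lx Ly p' q'"
proof -
  have "[i div Ly + p = i div Ly + p'] (mod Lx)" "[i mod Ly + q = i mod Ly + q'] (mod Ly)"
    using assms translate_div translate_mod unfolding cong_def by metis+
  then have "[k + p = k + p'] (mod Lx)" "[k + q = k + q'] (mod Ly)" for k
    by (simp_all add: cong_add_lcancel_nat)
  then show ?thesis
    by (simp add: translate_def cong_def fun_eq_iff)
qed

section \<open>Permutation matrices of translations\<close>

text \<open>The orientation follows \<open>cyclic_shift\<close>, so that \<open>gb_x\<close> and
  \<open>gb_y\<close> become the translations by \<open>(1, 0)\<close> and \<open>(0, 1)\<close> and
  not their inverses.\<close>

definition translation_mat :: "nat \<Rightarrow> nat \<Rightarrow> nat \<Rightarrow> nat \<Rightarrow> bit mat" where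
  "translation_mat Lx Ly p q =
    mat (Lx * Ly) (Lx * Ly) (\<lambda>(i, j). if j = translate Lx Ly p q i then 1 else 0)"

lemma translation_mat_carrier:
  "translation_mat Lx Ly p q \<in> carrier_mat (Lx * Ly) (Lx * Ly)"
  by (simp add: translation_mat_def)

lemma translation_mat_mult:
  assumes "0 < Lx" "0 < Ly"
  shows "translation_mat Lx Ly p q * translation_mat Lx Ly p' q' =
    translation_mat Lx Ly (p + p') (q + q')"
proof (rule eq_matI)
  fix i j
  assume "i < dim_row (translation_mat Lx Ly (p + p') (q + q'))"
    and "j < dim_col (translation_mat Lx Ly (p + p') (q + q'))"
  then have ij: "i < Lx * Ly" "j < Lx * Ly"
    by (simp_all add: translation_mat_def)
  let ?k = "translate Lx Ly p q i"
  have "(translation_mat Lx Ly p q * translation_mat Lx Ly p' q') $$ (i, j) =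
      (\<Sum>k = 0..<Lx * Ly. (if k = ?k then 1 else 0) * (if j = translate Lx Ly p' q' k then 1 else 0))"
    using ij by (simp add: translation_mat_def scalar_prod_def)
  \<comment> \<open>Row \<open>i\<close> of the first factor is nonzero only at column
    \<open>?k\<close>, which collapses the sum.\<close>
  also have "\<dots> = (\<Sum>k = 0..<Lx * Ly.
      if k = ?k then (if j = translate Lx Ly p' q' k then 1 else 0) else 0)"
    by (rule sum.cong) auto
  also have "\<dots> = (if j = translate Lx Ly p' q' ?k then 1 else 0)"
    using translate_less[OF assms] by simp
  also have "\<dots> = translation_mat Lx Ly (p + p') (q + q') $$ (i, j)"
    using ij assms by (simp add: translation_mat_def translate_translate)
  finally show "(translation_mat Lx Ly p q * translation_mat Lx Ly p' q') $$ (i, j) =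
    translation_mat Lx Ly (p + p') (q + q') $$ (i, j)" .
qed (simp_all add: translation_mat_def)

lemma translation_mat_zero: "translation_mat Lx Ly 0 0 = 1\<^sub>m (Lx * Ly)"
  by (rule eq_matI) (auto simp: translation_mat_def translate_zero)

lemma translation_mat_power:
  assumes "0 < Lx" "0 < Ly"
  shows "translation_mat Lx Ly p q ^\<^sub>m k = translation_mat Lx Ly (k * p) (k * q)"
proof (induction k)
  case 0
  show ?case
    \<comment> \<open>Unfolding \<open>translation_mat\<close> is delayed to the second call, where
      it only evaluates the dimension of the identity matrix that the zeroth power yields.\<close>
    by (simp add: translation_mat_zero) (simp add: translation_mat_def)
next
  case (Suc k)
  then show ?case
    using assms by (simp add: translation_mat_mult add.commute)
qed

text \<open>A Kronecker product reads its factors at quotients and remainders separately, and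
  \<open>eq_translate_iff\<close> splits the translation in the same way.\<close>

lemma gb_x_eq_translation_mat:
  assumes "0 < Ly"
  shows "gb_x Lx Ly = translation_mat Lx Ly 1 0"
  using assms
  by (intro eq_matI)
    (auto simp: gb_x_def translation_mat_def kronecker_def cyclic_shift_def less_mult_imp_div_less
      eq_translate_iff)

lemma gb_y_eq_translation_mat:
  assumes "0 < Ly"
  shows "gb_y Lx Ly = translation_mat Lx Ly 0 1"
  using assms
  by (intro eq_matI)
    (auto simp: gb_y_def translation_mat_def kronecker_def cyclic_shift_def less_mult_imp_div_less
      eq_translate_iff)

lemma monomials_translation_mat:
  assumes "0 < Lx" "0 < Ly" "M \<in> monomials Lx Ly"
  shows "\<exists>p q. M = translation_mat Lx Ly p q"
proof -
  obtain p q where "M = gb_x Lx Ly ^\<^sub>m p * gb_y Lx Ly ^\<^sub>m q"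
    using assms(3) by (auto simp: monomials_def)
  then have "M = translation_mat Lx Ly p q"
    using assms(1,2)
    by (simp add: gb_x_eq_translation_mat gb_y_eq_translation_mat
        translation_mat_power translation_mat_mult)
  then show ?thesis
    by blast
qed

section \<open>Reading the translation off a monomial\<close>

text \<open>Exponents of a monomial are not unique, so the permutation is recovered from the matrix
  itself.\<close>

definition shift_of :: "bit mat \<Rightarrow> nat \<Rightarrow> nat" where
  "shift_of M i = (THE j. j < dim_col M \<and> M $$ (i, j) = 1)"

lemma shift_of_translation_mat:
  assumes "0 < Lx" "0 < Ly" "i < Lx * Ly"
  shows "shift_of (translation_mat Lx Ly p q) i = translate Lx Ly p q i"
  unfolding shift_of_def
  by (rule the_equality)
    (use assms translate_less[of Lx Ly p q i] in \<open>auto simp: translation_mat_def split: if_splits\<close>)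

context
  fixes Lx Ly N :: nat
  assumes pos: "0 < Lx" "0 < Ly" and N: "N = Lx * Ly"
begin

lemma monomial_carrier: "M \<in> monomials Lx Ly \<Longrightarrow> M \<in> carrier_mat N N"
  by (auto simp: N translation_mat_carrier dest!: monomials_translation_mat[OF pos])

lemma monomial_entry:
  assumes "M \<in> monomials Lx Ly" "i < N" "j < N"
  shows "M $$ (i, j) = (if j = shift_of M i then 1 else 0)"
proof -
  obtain p q where M: "M = translation_mat Lx Ly p q"
    using monomials_translation_mat[OF pos assms(1)] by blast
  then have "shift_of M i = translate Lx Ly p q i"
    using assms pos by (simp add: N shift_of_translation_mat)
  then show ?thesis
    using assms by (simp add: M N translation_mat_def)
qed

lemma shift_of_less: "M \<in> monomials Lx Ly \<Longrightarrow> i < N \<Longrightarrow> shift_of M i < N"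
  using pos
  by (auto simp: N shift_of_translation_mat translate_less dest!: monomials_translation_mat[OF pos])

lemma shift_of_commute:
  assumes "M \<in> monomials Lx Ly" "M' \<in> monomials Lx Ly" "i < N"
  shows "shift_of M (shift_of M' i) = shift_of M' (shift_of M i)"
proof -
  obtain p q p' q' where "M = translation_mat Lx Ly p q" "M' = translation_mat Lx Ly p' q'"
    using assms(1,2)[THEN monomials_translation_mat[OF pos]] by blast
  then show ?thesis
    using assms(3) pos
    by (simp add: N shift_of_translation_mat translate_less translate_commute)
qed

text \<open>By freeness of translations, agreement at one index forces equality; hence distinct
  monomials have disjoint supports.\<close>

lemma shift_of_eq_iff:
  assumes "M \<in> monomials Lx Ly" "M' \<in> monomials Lx Ly" "i < N"
  shows "shift_of M i = shift_of M' i \<longleftrightarrow> M = M'"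
proof
  assume eq: "shift_of M i = shift_of M' i"
  obtain p q p' q' where M: "M = translation_mat Lx Ly p q" "M' = translation_mat Lx Ly p' q'"
    using assms(1,2)[THEN monomials_translation_mat[OF pos]] by blast
  then have "translate Lx Ly p q i = translate Lx Ly p' q' i"
    using eq assms(3) pos by (simp add: N shift_of_translation_mat)
  then show "M = M'"
    using translate_eq_everywhere[OF pos(2)] by (metis M translation_mat_def)
qed simp

text \<open>Modulo 2 this needs that distinct monomials have disjoint supports, so that nothing cancels.\<close>

lemma matrix_sum_entry_eq_1_iff:
  assumes M: "M ` {1..k} \<subseteq> monomials Lx Ly" and inj: "inj_on M {1..k}" and ij: "i < N" "j < N"
  shows "matrix_sum N k M $$ (i, j) = 1 \<longleftrightarrow> (\<exists>t \<in> {1..k}. j = shift_of (M t) i)"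
proof -
  have entry: "M t $$ (i, j) = (if j = shift_of (M t) i then 1 else 0)" if "t \<in> {1..k}" for t
    using M that ij by (intro monomial_entry) auto
  show ?thesis
  proof (cases "\<exists>t \<in> {1..k}. j = shift_of (M t) i")
    case True
    then obtain s where s: "s \<in> {1..k}" "j = shift_of (M s) i"
      by blast
    have "j = shift_of (M t) i \<longleftrightarrow> t = s" if "t \<in> {1..k}" for t
    proof -
      have "M t \<in> monomials Lx Ly" "M s \<in> monomials Lx Ly"
        using M s that by auto
      then show ?thesis
        using s that ij inj_on_eq_iff[OF inj] by (auto simp: shift_of_eq_iff)
    qed
    then have "(\<Sum>t = 1..k. M t $$ (i, j)) = (\<Sum>t = 1..k. if t = s then 1 else 0)"
      by (intro sum.cong) (simp_all add: entry)
    then show ?thesis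
      using s ij by (auto simp: matrix_sum_def)
  next
    case False
    then have "(\<Sum>t = 1..k. M t $$ (i, j)) = 0"
      by (intro sum.neutral) (auto simp: entry)
    then show ?thesis
      using False ij by (simp add: matrix_sum_def)
  qed
qed

text \<open>Evaluates the \<open>THE\<close> in \<open>label_of\<close>; uniqueness is disjointness
  of supports.\<close>

lemma the_monomial_with_entry:
  assumes "S \<subseteq> monomials Lx Ly" "M \<in> S" "i < N" "j = shift_of M i"
  shows "(THE M. M \<in> S \<and> transpose_mat M $$ (j, i) = 1) = M"
proof (rule the_equality)
  have tr: "transpose_mat M' $$ (j, i) = 1 \<longleftrightarrow> shift_of M i = shift_of M' i" if "M' \<in> S" for M'
  proof -
    have "M' \<in> monomials Lx Ly" "M \<in> monomials Lx Ly"
      using that assms by auto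
    moreover have "j < N"
      using \<open>M \<in> monomials Lx Ly\<close> assms shift_of_less by simp
    ultimately show ?thesis
      using assms monomial_entry[of M' i j] monomial_carrier[of M'] by auto
  qed
  show "M \<in> S \<and> transpose_mat M $$ (j, i) = 1"
    using assms tr by simp
  show "M' = M" if "M' \<in> S \<and> transpose_mat M' $$ (j, i) = 1" for M'
    using that assms tr shift_of_eq_iff[of M M' i] by auto
qed

section \<open>The subgraph induced by a generator\<close>

context
  fixes m n r :: nat and Ai Bj :: "nat \<Rightarrow> bit mat" and A B :: "bit mat"
    and T :: "code_node tanner_graph"
  assumes Ai: "Ai ` {1..m} \<subseteq> monomials Lx Ly" "inj_on Ai {1..m}"
    and Bj: "Bj ` {1..n} \<subseteq> monomials Lx Ly" "inj_on Bj {1..n}"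
    and A: "A = matrix_sum N m Ai" and B: "B = matrix_sum N n Bj"
    and r: "r < N" and T: "T = generator_subgraph A B r"
begin

section \<open>Explicit nodes of the generator subgraph\<close>

definition var_a :: "nat \<Rightarrow> code_node" where
  "var_a i = Var (shift_of (Ai i) r)"

definition var_b :: "nat \<Rightarrow> code_node" where
  "var_b j = Var (N + shift_of (Bj j) r)"

definition check_ab :: "nat \<Rightarrow> nat \<Rightarrow> code_node" where
  "check_ab i j = Check (shift_of (Ai i) (shift_of (Bj j) r))"

lemma shift_less:
  "i \<in> {1..m} \<Longrightarrow> u < N \<Longrightarrow> shift_of (Ai i) u < N"
  "j \<in> {1..n} \<Longrightarrow> u < N \<Longrightarrow> shift_of (Bj j) u < N"
  using Ai(1) Bj(1) by (simp_all add: image_subset_iff shift_of_less)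

text \<open>Commutation of monomials lets the same check be reached from \<open>var_a i\<close> by
  \<open>Bj j\<close> and from \<open>var_b j\<close> by \<open>Ai i\<close>.\<close>

lemma check_ab_commute:
  "i \<in> {1..m} \<Longrightarrow> j \<in> {1..n} \<Longrightarrow> check_ab i j = Check (shift_of (Bj j) (shift_of (Ai i) r))"
  using Ai(1) Bj(1) r shift_of_commute[of "Ai i" "Bj j" r]
  by (simp add: check_ab_def image_subset_iff)

lemma dims: "dim_row A = N" "dim_col A = N" "dim_row B = N" "dim_col B = N"
  by (simp_all add: A B matrix_sum_def)

lemma A_entry: "u < N \<Longrightarrow> v < N \<Longrightarrow> A $$ (u, v) = 1 \<longleftrightarrow> (\<exists>i \<in> {1..m}. v = shift_of (Ai i) u)"
  unfolding A by (rule matrix_sum_entry_eq_1_iff[OF Ai])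

lemma B_entry: "u < N \<Longrightarrow> v < N \<Longrightarrow> B $$ (u, v) = 1 \<longleftrightarrow> (\<exists>j \<in> {1..n}. v = shift_of (Bj j) u)"
  unfolding B by (rule matrix_sum_entry_eq_1_iff[OF Bj])

lemma generator_var_nodes: "var_nodes T = var_a ` {1..m} \<union> var_b ` {1..n}"
proof -
  have neq: "N + u \<noteq> shift_of (Ai i) r" if "i \<in> {1..m}" for u i
    using shift_less(1)[OF that r] by simp
  have "v < 2 * N \<and> H_X A B $$ (r, v) = 1 \<longleftrightarrow>
      (\<exists>i \<in> {1..m}. v = shift_of (Ai i) r) \<or> (\<exists>j \<in> {1..n}. v = N + shift_of (Bj j) r)" for v
  proof (cases "v < N")
    case True
    then show ?thesis
      using r by (auto simp: H_X_def hconcat_def dims A_entry simp del: One_nat_def)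
  next
    case False
    then obtain u where "v = N + u"
      using le_Suc_ex not_less by blast
    \<comment> \<open>For \<open>u \<ge> N\<close> both sides fail, because all shifts of
      \<open>r\<close> stay below \<open>N\<close>.\<close>
    then show ?thesis
      using r neq shift_less(2)[OF _ r]
      by (cases "u < N") (auto simp: H_X_def hconcat_def dims B_entry simp del: One_nat_def)
  qed
  then show ?thesis
    by (auto simp: T generator_subgraph_def induced_by_def row_support_def H_X_def hconcat_def dims
        var_a_def var_b_def mult_2)
qed

section \<open>Edges and checks\<close>

text \<open>The transposition in \<open>H_Z\<close> turns an entry into \<open>B $$ (u, v)\<close>,
  so edges follow the translations themselves and not their inverses.\<close>

lemma tanner_edge_first_block:
  assumes "u < N"
  shows "(Var u, w) \<in> edges (tanner_graph_of (H_Z A B)) \<longleftrightarrow>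
    (\<exists>j \<in> {1..n}. w = Check (shift_of (Bj j) u))"
proof -
  have "(Var u, w) \<in> edges (tanner_graph_of (H_Z A B)) \<longleftrightarrow>
      (\<exists>v. w = Check v \<and> v < N \<and> B $$ (u, v) = 1)"
    using assms by (auto simp: tanner_graph_of_def H_Z_def hconcat_def dims)
  then show ?thesis
    using B_entry[OF assms] shift_less(2)[OF _ assms] by blast
qed

lemma tanner_edge_second_block:
  assumes "u < N"
  shows "(Var (N + u), w) \<in> edges (tanner_graph_of (H_Z A B)) \<longleftrightarrow>
    (\<exists>i \<in> {1..m}. w = Check (shift_of (Ai i) u))"
proof -
  have "(Var (N + u), w) \<in> edges (tanner_graph_of (H_Z A B)) \<longleftrightarrow>
      (\<exists>v. w = Check v \<and> v < N \<and> A $$ (u, v) = 1)"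
    using assms by (auto simp: tanner_graph_of_def H_Z_def hconcat_def dims)
  then show ?thesis
    using A_entry[OF assms] shift_less(1)[OF _ assms] by blast
qed

lemma tanner_edge_var_a:
  assumes "i \<in> {1..m}"
  shows "(var_a i, w) \<in> edges (tanner_graph_of (H_Z A B)) \<longleftrightarrow> (\<exists>j \<in> {1..n}. w = check_ab i j)"
  using assms shift_less(1)[OF assms r] unfolding var_a_def
  by (subst tanner_edge_first_block) (auto simp: check_ab_commute)

lemma tanner_edge_var_b:
  assumes "j \<in> {1..n}"
  shows "(var_b j, w) \<in> edges (tanner_graph_of (H_Z A B)) \<longleftrightarrow> (\<exists>i \<in> {1..m}. w = check_ab i j)"
  using assms shift_less(2)[OF assms r] unfolding var_b_def
  by (subst tanner_edge_second_block) (auto simp: check_ab_def)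

lemma generator_edge_iff:
  "(v, w) \<in> edges T \<longleftrightarrow> v \<in> var_nodes T \<and> (v, w) \<in> edges (tanner_graph_of (H_Z A B))"
  by (auto simp: T generator_subgraph_def induced_by_def)

lemma generator_edges:
  "edges T = (\<lambda>(i, j). (var_a i, check_ab i j)) ` ({1..m} \<times> {1..n}) \<union>
    (\<lambda>(i, j). (var_b j, check_ab i j)) ` ({1..m} \<times> {1..n})" (is "_ = ?E")
proof -
  have "(v, w) \<in> edges T \<longleftrightarrow> (v, w) \<in> ?E" for v w
  proof -
    have "(v, w) \<in> edges T \<longleftrightarrow>
        (\<exists>i \<in> {1..m}. v = var_a i \<and> (var_a i, w) \<in> edges (tanner_graph_of (H_Z A B))) \<or>
        (\<exists>j \<in> {1..n}. v = var_b j \<and> (var_b j, w) \<in> edges (tanner_graph_of (H_Z A B)))"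
      by (auto simp: generator_edge_iff generator_var_nodes)
    also have "\<dots> \<longleftrightarrow>
        (\<exists>i \<in> {1..m}. v = var_a i \<and> (\<exists>j \<in> {1..n}. w = check_ab i j)) \<or>
        (\<exists>j \<in> {1..n}. v = var_b j \<and> (\<exists>i \<in> {1..m}. w = check_ab i j))"
      using tanner_edge_var_a tanner_edge_var_b by blast
    also have "\<dots> \<longleftrightarrow> (v, w) \<in> ?E"
      by (fastforce simp del: One_nat_def)
    finally show ?thesis .
  qed
  then show ?thesis
    unfolding set_eq_iff split_paired_All by blast
qed

text \<open>Each induced check has a neighbour in the support, so the checks are the second
  components of the edges.\<close>

lemma generator_check_nodes: "check_nodes T = (\<lambda>(i, j). check_ab i j) ` ({1..m} \<times> {1..n})"
proof -
  have "w \<in> check_nodes T \<longleftrightarrow> (\<exists>v. (v, w) \<in> edges T)" for w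
    by (auto simp: T generator_subgraph_def induced_by_def tanner_graph_of_def)
  then have "check_nodes T = snd ` edges T"
    by force
  then show ?thesis
    by (simp add: generator_edges image_Un image_image case_prod_unfold)
qed

section \<open>Separation of the blocks and distinctness of the checks\<close>

lemma var_a_in_blocks: "i \<in> {1..m} \<Longrightarrow> var_a i \<in> first_block N - second_block N"
  using shift_less(1)[of i r] r by (auto simp: var_a_def first_block_def second_block_def)

lemma var_b_in_blocks: "j \<in> {1..n} \<Longrightarrow> var_b j \<in> second_block N - first_block N"
  using shift_less(2)[of j r] r by (auto simp: var_b_def first_block_def second_block_def)

lemma generator_first_block: "var_nodes T \<inter> first_block N = var_a ` {1..m}"
  using var_a_in_blocks var_b_in_blocks unfolding generator_var_nodes by blast

lemma generator_second_block: "var_nodes T \<inter> second_block N = var_b ` {1..n}"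
  using var_a_in_blocks var_b_in_blocks unfolding generator_var_nodes by blast

text \<open>Here the subdivided \<open>K_{m,n}\<close> enters: the isomorphism yields
  \<open>m * n\<close> checks, so the surjection from the finite set of index pairs onto the checks
  is injective.\<close>

lemma inj_on_check_ab:
  assumes "is_subdivided_K T P Q m n"
  shows "inj_on (\<lambda>(i, j). check_ab i j) ({1..m} \<times> {1..n})"
proof (rule eq_card_imp_inj_on)
  obtain \<phi> where \<phi>: "tanner_iso T (subdivided_K m n) \<phi>"
    using assms by (auto simp: is_subdivided_K_def)
  have "card (check_nodes T) = card (check_nodes (subdivided_K m n))"
    \<comment> \<open>\<open>\<phi>\<close> is injective on all nodes, hence on the checks
      alone.\<close>
    using \<phi> unfolding tanner_iso_def bij_betw_def
    by (metis card_image inj_on_Un)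
  also have "check_nodes (subdivided_K m n) = (\<lambda>(i, j). Mid i j) ` ({1..m} \<times> {1..n})"
    by (auto simp: subdivided_K_def)
  also have "card \<dots> = card ({1..m} \<times> {1..n})"
    by (intro card_image) (auto simp: inj_on_def)
  finally show "card ((\<lambda>(i, j). check_ab i j) ` ({1..m} \<times> {1..n})) = card ({1..m} \<times> {1..n})"
    by (simp only: generator_check_nodes)
qed simp

text \<open>The left half of \<open>H_Z\<close> is the transpose of \<open>B\<close>, so first-block
  edges carry labels from \<open>B\<close> and second-block edges labels from
  \<open>A\<close>.\<close>

lemma label_indexed_generator_subgraph:
  assumes "is_subdivided_K T P Q m n"
  shows "label_indexed_graph T (label_of N (Ai ` {1..m}) (Bj ` {1..n})) {1..m} {1..n}
    var_a var_b check_ab (\<lambda>j. LabelB (Bj j)) (\<lambda>i. LabelA (Ai i))"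
proof
  have "var_a ` {1..m} \<subseteq> first_block N" "var_b ` {1..n} \<inter> first_block N = {}"
    using var_a_in_blocks var_b_in_blocks by blast+
  then show "var_a ` {1..m} \<inter> var_b ` {1..n} = {}"
    by blast
  show "inj_on (\<lambda>(i, j). check_ab i j) ({1..m} \<times> {1..n})"
    by (rule inj_on_check_ab[OF assms])
  show "inj_on (\<lambda>j. LabelB (Bj j)) {1..n}" "inj_on (\<lambda>i. LabelA (Ai i)) {1..m}"
    by (auto intro!: inj_onI dest: inj_onD[OF Ai(2)] inj_onD[OF Bj(2)])
  show "(\<lambda>j. LabelB (Bj j)) ` {1..n} \<inter> (\<lambda>i. LabelA (Ai i)) ` {1..m} = {}"
    by auto
  fix i j
  assume i: "i \<in> {1..m}" and j: "j \<in> {1..n}"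
  \<comment> \<open>The check must be written as the \<open>Bj j\<close> translate of the index of
    \<open>var_a i\<close> before the \<open>THE\<close> can be evaluated.\<close>
  show "label_of N (Ai ` {1..m}) (Bj ` {1..n}) (var_a i, check_ab i j) = LabelB (Bj j)"
    using the_monomial_with_entry[OF Bj(1) imageI[OF j] shift_less(1)[OF i r] refl]
      shift_less(1)[OF i r]
    by (simp add: check_ab_commute[OF i j] var_a_def del: One_nat_def)
  \<comment> \<open>By definition the check already is the \<open>Ai i\<close> translate of the
    index of \<open>var_b j\<close> with the offset \<open>N\<close> removed.\<close>
  show "label_of N (Ai ` {1..m}) (Bj ` {1..n}) (var_b j, check_ab i j) = LabelA (Ai i)"
    using the_monomial_with_entry[OF Ai(1) imageI[OF i] shift_less(2)[OF j r] refl]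
    by (simp add: check_ab_def var_b_def del: One_nat_def)
qed (fact generator_var_nodes generator_check_nodes generator_edges)+

end

end

theorem theorem2:
  fixes Lx Ly m n N r :: nat
    and Ai Bj :: "nat \<Rightarrow> bit mat"
    and A B :: "bit mat"
    and T :: "code_node tanner_graph"
    and \<A> \<B> :: "code_node set"
    and lab :: "code_node \<times> code_node \<Rightarrow> edge_label"
    and \<alpha> \<beta> :: "nat \<Rightarrow> edge_label"
    and \<eta> :: "code_node \<Rightarrow> edge_label \<times> edge_label"
  assumes "Lx \<ge> 1" and "Ly \<ge> 1" and "m \<ge> 1" and "n \<ge> 1"
    and N: "N = Lx * Ly"
    and "Ai ` {1..m} \<subseteq> monomials Lx Ly" and "inj_on Ai {1..m}"
    and "Bj ` {1..n} \<subseteq> monomials Lx Ly" and "inj_on Bj {1..n}"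
    and A: "A = matrix_sum N m Ai" and B: "B = matrix_sum N n Bj"
    and "r < N"
    and T: "T = generator_subgraph A B r"
    and \<A>: "\<A> = var_nodes T \<inter> first_block N"
    and \<B>: "\<B> = var_nodes T \<inter> second_block N"
    and "is_subdivided_K T \<A> \<B> m n"
    and lab: "lab = label_of N (Ai ` {1..m}) (Bj ` {1..n})"
    and \<alpha>: "\<And>j. \<alpha> j = LabelB (Bj j)"
    and \<beta>: "\<And>i. \<beta> i = LabelA (Ai i)"
    and \<eta>: "\<eta> = label_pair T \<A> \<B> lab"
  shows "(\<forall>c \<in> check_nodes T. check_degree T c = 2 \<longrightarrow>
            (\<exists>!a. a \<in> \<A> \<and> (a, c) \<in> edges T) \<and> (\<exists>!b. b \<in> \<B> \<and> (b, c) \<in> edges T) \<and>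
            (\<exists>j \<in> {1..n}. \<exists>i \<in> {1..m}. \<eta> c = (\<alpha> j, \<beta> i))) \<and>
         inj_on \<eta> {c \<in> check_nodes T. check_degree T c = 2} \<and>
         (\<forall>j \<in> {1..n}. \<forall>i \<in> {1..m}.
            \<exists>!c. c \<in> check_nodes T \<and> check_degree T c = 2 \<and> \<eta> c = (\<alpha> j, \<beta> i)) \<and>
         (\<forall>\<psi> P. color_preserving_automorphism T lab \<psi> \<and> P \<subseteq> var_nodes T \<longrightarrow> \<psi> ` P = P)"
proof -
  have pos: "0 < Lx" "0 < Ly"
    using assms(1,2) by auto
  \<comment> \<open>Discharges, in this order, the assumptions of the two contexts in the lemmas
    exported from them.\<close>
  note code = pos N \<open>Ai ` {1..m} \<subseteq> monomials Lx Ly\<close> \<open>inj_on Ai {1..m}\<close>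
    \<open>Bj ` {1..n} \<subseteq> monomials Lx Ly\<close> \<open>inj_on Bj {1..n}\<close> A B \<open>r < N\<close> T
  define a b c where "a = var_a r Ai" and "b = var_b N r Bj" and "c = check_ab r Ai Bj"
  have \<A>_eq: "\<A> = a ` {1..m}" and \<B>_eq: "\<B> = b ` {1..n}"
    unfolding \<A> \<B> a_def b_def
    by (rule generator_first_block[OF code] generator_second_block[OF code])+
  \<comment> \<open>\<open>\<alpha>\<close> and \<open>\<beta>\<close> are given pointwise;
    \<open>ext\<close> turns this into equations between functions that can be unfolded.\<close>
  interpret label_indexed_graph T lab "{1..m}" "{1..n}" a b c \<alpha> \<beta>
    unfolding a_def b_def c_def lab ext[OF \<alpha>] ext[OF \<beta>]
    by (rule label_indexed_generator_subgraph[OF code]) fact+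
  have \<eta>_eq: "\<eta> = label_pair T (a ` {1..m}) (b ` {1..n}) lab"
    unfolding \<eta> \<A>_eq \<B>_eq ..
  show ?thesis
  proof (intro conjI ballI allI impI)
    fix w
    assume "w \<in> check_nodes T"
    then obtain i j where ij: "i \<in> {1..m}" "j \<in> {1..n}" "w = c i j"
      by (rule check_nodeE)
    show "\<exists>!v. v \<in> \<A> \<and> (v, w) \<in> edges T" "\<exists>!v. v \<in> \<B> \<and> (v, w) \<in> edges T"
      unfolding \<A>_eq \<B>_eq using ij
      by (simp_all add: neighbor_a_iff neighbor_b_iff del: One_nat_def)
    show "\<exists>j \<in> {1..n}. \<exists>i \<in> {1..m}. \<eta> w = (\<alpha> j, \<beta> i)"
      unfolding \<eta>_eq using ij label_pair_c by blast
  next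
    show "inj_on \<eta> {c \<in> check_nodes T. check_degree T c = 2}"
      unfolding \<eta>_eq using inj_on_label_pair by (rule inj_on_subset) auto
  next
    fix i j
    assume "i \<in> {1..m}" "j \<in> {1..n}"
    then show "\<exists>!c. c \<in> check_nodes T \<and> check_degree T c = 2 \<and> \<eta> c = (\<alpha> j, \<beta> i)"
      unfolding \<eta>_eq by (rule ex1_check_with_labels)
  next
    fix \<psi> P
    assume "color_preserving_automorphism T lab \<psi> \<and> P \<subseteq> var_nodes T"
    \<comment> \<open>The bounds on \<open>m\<close> and \<open>n\<close> make both index ranges
      nonempty.\<close>
    then show "\<psi> ` P = P"
      using \<open>m \<ge> 1\<close> \<open>n \<ge> 1\<close> by (intro color_preserving_automorphism_image) auto
  qed
qed

end
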